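(* For all integers $n>1$, $$d_{\mathrm{GH}}(\mathbb{S}^1,\mathbb{S}^n)\geq \pi\cdot \max\left\{\frac{1}{3},\ \frac{1}{2}\cdot\frac{n-1}{n+1}\right\}.$$
   Context: For an integer $m\ge 0$, $\mathbb{S}^m=\{x\in\mathbb{R}^{m+1}:\|x\|=1\}$ is the unit sphere with the geodesic distance $d_{\mathbb{S}^m}(x,x')=\arccos\langle x,x'\rangle$. The Gromov-Hausdorff distance between bounded metric spaces $X,Y$ is $d_{\mathrm{GH}}(X,Y)=\inf d_{\mathrm{H}}(f(X),g(Y))$, the infimum being over all metric spaces $Z$ and all isometric (distance-preserving) embeddings $f:X\to Z$, $g:Y\to Z$, with $d_{\mathrm{H}}$ the Hausdorff distance in $Z$. Equivalently $d_{\mathrm{GH}}(X,Y)=\frac12\inf_R \operatorname{dis}(R)$, where $R\subseteq X\times Y$ ranges over correspondences (relations whose projections to $X$ and to $Y$ are both surjective) and $\operatorname{dis}(R)=\sup_{(x,y),(x',y')\in R}|d_X(x,x')-d_Y(y,y')|$. *)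

theory Defs
  imports "HOL-Analysis.Analysis"
begin

text \<open>
  The guard is there because a metric in the sense of \<^locale>\<open>Metric_space\<close> has to be
  nonnegative and symmetric on the whole type, while \<^const>\<open>arccos\<close> is unspecified outside
  \<open>[-1, 1]\<close>.
\<close>

definition geodesic_dist :: "'a::euclidean_space \<Rightarrow> 'a \<Rightarrow> real" where
  "geodesic_dist x y =
     (if x \<in> sphere 0 1 \<and> y \<in> sphere 0 1 then arccos (x \<bullet> y) else 0)"

definition geodesic_sphere :: "'a::euclidean_space metric" where
  "geodesic_sphere = metric (sphere 0 1, geodesic_dist)"

lemma abs_inner_sphere_le_1:
  fixes x y :: "'a::euclidean_space"
  assumes "x \<in> sphere 0 1" "y \<in> sphere 0 1"
  shows "\<bar>x \<bullet> y\<bar> \<le> 1"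
  using Cauchy_Schwarz_ineq2[of x y] assms by simp

lemma arccos_inner_triangle:
  fixes x y z :: "'a::euclidean_space"
  assumes "x \<in> sphere 0 1" "y \<in> sphere 0 1" "z \<in> sphere 0 1"
  shows "arccos (x \<bullet> z) \<le> arccos (x \<bullet> y) + arccos (y \<bullet> z)"
proof -
  define u where "u = x \<bullet> y"
  define v where "v = y \<bullet> z"
  have xx: "x \<bullet> x = 1" and yy: "y \<bullet> y = 1" and zz: "z \<bullet> z = 1"
    using assms by (simp_all add: norm_eq_1)
  have u: "\<bar>u\<bar> \<le> 1" and v: "\<bar>v\<bar> \<le> 1" and w: "\<bar>x \<bullet> z\<bar> \<le> 1"
    using abs_inner_sphere_le_1 assms by (simp_all add: u_def v_def)
  define p where "p = x - u *\<^sub>R y"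
  define q where "q = z - v *\<^sub>R y"
  have "p \<bullet> p = 1 - u\<^sup>2"
    using xx yy by (simp add: p_def u_def inner_diff_left inner_diff_right
        inner_commute power2_eq_square)
  moreover have "q \<bullet> q = 1 - v\<^sup>2"
    using zz yy by (simp add: q_def v_def inner_diff_left inner_diff_right
        inner_commute power2_eq_square)
  moreover have pq: "p \<bullet> q = x \<bullet> z - u * v"
    using yy by (simp add: p_def q_def u_def v_def inner_diff_left inner_diff_right
        inner_commute)
  ultimately have "\<bar>x \<bullet> z - u * v\<bar> \<le> sqrt (1 - u\<^sup>2) * sqrt (1 - v\<^sup>2)"
    using Cauchy_Schwarz_ineq2[of p q] by (simp add: norm_eq_sqrt_inner)
  then have ge: "u * v - sqrt (1 - u\<^sup>2) * sqrt (1 - v\<^sup>2) \<le> x \<bullet> z"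
    by linarith
  let ?a = "arccos u" and ?b = "arccos v"
  have cs: "cos (?a + ?b) = u * v - sqrt (1 - u\<^sup>2) * sqrt (1 - v\<^sup>2)"
    using u v by (simp add: cos_add cos_arccos_abs sin_arccos_abs)
  have ab: "0 \<le> ?a" "0 \<le> ?b" using u v by (simp_all add: arccos_lbound)
  show ?thesis
  proof (cases "?a + ?b \<le> pi")
    case True
    have "arccos (x \<bullet> z) \<le> arccos (cos (?a + ?b))"
      using ge w cos_ge_minus_one[of "?a + ?b"] unfolding cs
      by (intro arccos_le_arccos) auto
    also have "\<dots> = ?a + ?b" using True ab by (intro arccos_cos) auto
    finally show ?thesis by (simp add: u_def v_def)
  next
    case False
    moreover have "arccos (x \<bullet> z) \<le> pi" using w by (intro arccos_ubound) auto
    ultimately show ?thesis by (simp add: u_def v_def)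
  qed
qed

lemma Metric_space_geodesic_sphere:
  "Metric_space (sphere (0::'a::euclidean_space) 1) geodesic_dist"
proof
  fix x y z :: 'a
  show "0 \<le> geodesic_dist x y"
    using abs_inner_sphere_le_1[of x y] by (auto simp: geodesic_dist_def intro!: arccos_lbound)
  show "geodesic_dist x y = geodesic_dist y x"
    by (simp add: geodesic_dist_def inner_commute)
  assume x: "x \<in> sphere 0 1" and y: "y \<in> sphere 0 1"
  have "arccos (x \<bullet> y) = 0 \<longleftrightarrow> x \<bullet> y = 1"
    using abs_inner_sphere_le_1[OF x y] by (metis arccos_1 cos_arccos_abs cos_zero)
  also have "\<dots> \<longleftrightarrow> x = y"
  proof
    assume "x \<bullet> y = 1"
    then have "(x - y) \<bullet> (x - y) = 0"
      using x y by (simp add: inner_diff_left inner_diff_right inner_commute norm_eq_1)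
    then show "x = y" by simp
  qed (use x in \<open>simp add: norm_eq_1\<close>)
  finally show "geodesic_dist x y = 0 \<longleftrightarrow> x = y"
    using x y by (simp add: geodesic_dist_def)
  assume z: "z \<in> sphere 0 1"
  show "geodesic_dist x z \<le> geodesic_dist x y + geodesic_dist y z"
    using arccos_inner_triangle[OF x y z] x y z by (simp add: geodesic_dist_def)
qed

lemma mspace_geodesic_sphere [simp]:
  "mspace geodesic_sphere = sphere (0::'a::euclidean_space) 1"
  using Metric_space.mspace_metric[OF Metric_space_geodesic_sphere]
  by (simp add: geodesic_sphere_def)

lemma mdist_geodesic_sphere:
  fixes x y :: "'a::euclidean_space"
  assumes "x \<in> sphere 0 1" "y \<in> sphere 0 1"
  shows "mdist geodesic_sphere x y = arccos (x \<bullet> y)"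
  using assms
  by (simp add: geodesic_sphere_def geodesic_dist_def
      Metric_space.mdist_metric[OF Metric_space_geodesic_sphere])

definition isometric_embedding :: "'a metric \<Rightarrow> 'b metric \<Rightarrow> ('a \<Rightarrow> 'b) \<Rightarrow> bool" where
  "isometric_embedding X Z f \<longleftrightarrow>
     f \<in> mspace X \<rightarrow> mspace Z \<and>
     (\<forall>x\<in>mspace X. \<forall>x'\<in>mspace X. mdist Z (f x) (f x') = mdist X x x')"

text \<open>
  Meant for nonempty bounded sets: the suprema and infima are taken in \<^typ>\<open>real\<close>, so they are
  unspecified otherwise.
\<close>

definition hausdorff_dist :: "'a metric \<Rightarrow> 'a set \<Rightarrow> 'a set \<Rightarrow> real" where
  "hausdorff_dist Z A B =
     max (SUP a\<in>A. INF b\<in>B. mdist Z a b) (SUP b\<in>B. INF a\<in>A. mdist Z a b)"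

text \<open>
  Only ambient spaces \<open>Z\<close> carried by subsets of the type \<open>'a + 'b\<close> are considered, since one
  cannot quantify over types. No generality is lost: only the subspace \<open>f(X) \<union> g(Y)\<close> of \<open>Z\<close>
  matters, and this has an isometric copy in \<open>'a + 'b\<close>; see the lemma that follows.
\<close>

definition GH_dist :: "'a metric \<Rightarrow> 'b metric \<Rightarrow> real" where
  "GH_dist X Y =
     Inf {hausdorff_dist Z (f ` mspace X) (g ` mspace Y) | (Z :: ('a + 'b) metric) f g.
            isometric_embedding X Z f \<and> isometric_embedding Y Z g}"

lemma GH_dist_ambient_space_wlog:
  fixes X :: "'a metric" and Y :: "'b metric" and Z :: "'c metric"
  assumes f: "isometric_embedding X Z f" and g: "isometric_embedding Y Z g"
  obtains Z' :: "('a + 'b) metric" and f' g' where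
    "isometric_embedding X Z' f'" "isometric_embedding Y Z' g'"
    "hausdorff_dist Z' (f' ` mspace X) (g' ` mspace Y) =
     hausdorff_dist Z (f ` mspace X) (g ` mspace Y)"
proof -
  let ?A = "f ` mspace X" and ?B = "g ` mspace Y"
  define h where "h z = (if z \<in> ?A then Inl (inv_into (mspace X) f z)
                         else Inr (inv_into (mspace Y) g z))" for z
  define k where "k = case_sum f g"
  define M where "M = h ` (?A \<union> ?B)"
  define d where "d p q = mdist Z (k p) (k q)" for p q
  have kh: "k (h z) = z" if "z \<in> ?A \<union> ?B" for z
    using that by (auto simp: k_def h_def f_inv_into_f)
  have sub: "?A \<union> ?B \<subseteq> mspace Z"
    using f g by (auto simp: isometric_embedding_def)
  have M: "Metric_space M d"
  proof
    show "0 \<le> d p q" for p q by (simp add: d_def)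
    show "d p q = d q p" for p q by (simp add: d_def mdist_commute)
    fix p q assume p: "p \<in> M" and q: "q \<in> M"
    have kM: "k p \<in> mspace Z" if "p \<in> M" for p
      using that kh sub by (auto simp: M_def)
    have inj: "k p = k q \<longleftrightarrow> p = q"
      using p q kh unfolding M_def by (metis imageE)
    show "d p q = 0 \<longleftrightarrow> p = q"
      using kM p q inj by (simp add: d_def)
    fix r assume r: "r \<in> M"
    show "d p r \<le> d p q + d q r"
      using kM p q r by (simp add: d_def mdist_triangle)
  qed
  define Z' where "Z' = metric (M, d)"
  have mZ': "mspace Z' = M" and dZ': "mdist Z' = d"
    using M by (simp_all add: Z'_def Metric_space.mspace_metric Metric_space.mdist_metric)
  have dh: "mdist Z' (h z) (h w) = mdist Z z w" if "z \<in> ?A \<union> ?B" "w \<in> ?A \<union> ?B" for z w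
    using kh that by (simp add: dZ' d_def)
  have dhX: "mdist Z' (h (f x)) (h (g y)) = mdist Z (f x) (g y)"
    if "x \<in> mspace X" "y \<in> mspace Y" for x y using that dh by auto
  have f': "isometric_embedding X Z' (h \<circ> f)" and g': "isometric_embedding Y Z' (h \<circ> g)"
    using f g dh by (auto simp: isometric_embedding_def mZ' M_def)
  have "hausdorff_dist Z' ((h \<circ> f) ` mspace X) ((h \<circ> g) ` mspace Y) = hausdorff_dist Z ?A ?B"
    unfolding hausdorff_dist_def using dhX
    by (simp add: image_image cong: image_cong_simp)
  with f' g' show thesis by (rule that)
qed

end

theory Submission
  imports Defs "HOL-Library.Z2"
begin

text \<open>
  Suppose that the circle and the sphere \<open>S\<^sup>n\<close> lie isometrically in a common space at Hausdorff
  distance \<open>h\<close>. Sending every point of \<open>S\<^sup>n\<close> to a nearly closest point of the circle gives a map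
  \<open>\<psi> : S\<^sup>n \<rightarrow> S\<^sup>1\<close>, in general discontinuous, that changes distances by at most about \<open>2h\<close>. The
  map can be made odd without increasing its distortion: keep it on one point of each antipodal
  pair and extend by \<open>\<psi>(-x) = -\<psi>(x)\<close>; this works because passing to an antipode turns every
  spherical distance \<open>d\<close> into \<open>\<pi> - d\<close>. So it suffices to bound from below the jumps of an odd map
  from \<open>S\<^sup>n\<close> to the circle, that is, the distances between images of points that are arbitrarily
  close together.

  The bound comes from Ky Fan's lemma. Label a point \<open>\<plusminus>(cos t, sin t)\<close> of the circle, where
  \<open>0 \<le> t < \<pi>\<close>, by its sign and by the magnitude \<open>t\<close>; antipodes have opposite signs and equal
  magnitudes. If jumps stay below \<open>\<pi>\<close>, nearby points never have complementary labels, and Fan's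
  lemma (\<open>alternating_simplex\<close>) yields \<open>n + 1\<close> points of \<open>S\<^sup>n\<close>, arbitrarily close
  together, whose labels have alternating signs when ordered by magnitude
  \<open>t\<^sub>0 \<le> \<dots> \<le> t\<^sub>n\<close>. If the images have mutual distances at most \<open>\<rho>\<close>, then consecutive ones, being of
  opposite sign, satisfy \<open>\<pi> - (t\<^bsub>j+1\<^esub> - t\<^sub>j) \<le> \<rho>\<close>, so \<open>n (\<pi> - \<rho>) \<le> t\<^sub>n - t\<^sub>0\<close>. The right-hand side is
  at most \<open>\<pi>\<close>, and at most \<open>\<rho>\<close> if \<open>n\<close> is even because the extreme points then have the same sign.
  Hence \<open>\<rho> \<ge> \<pi> n / (n + 1)\<close> for even \<open>n\<close> and \<open>\<rho> \<ge> \<pi> (n - 1) / n\<close> for odd \<open>n\<close>. For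
  \<open>n \<ge> 2\<close> both numbers are at least \<open>2\<pi>/3\<close> and at least \<open>\<pi> (n - 1) / (n + 1)\<close>.

  Fan's lemma is proved by counting modulo 2. Chains are lists of simplices, and a simplex is a
  list of vertices. Starting from a point, the \<open>(i+1)\<close>-dimensional hemisphere is the cone over the
  \<open>i\<close>-dimensional sphere formed by the \<open>i\<close>-dimensional hemisphere and its antipode. This gives chains
  \<open>b\<^sub>i\<close> with \<open>\<partial> b\<^bsub>i+1\<^esub> = b\<^sub>i + T b\<^sub>i\<close> for the antipodal map \<open>T\<close>, and barycentric subdivision
  keeps this relation while making the simplices small. The cochain \<open>A\<^sub>s\<close> that
  detects simplices with alternating labels starting with sign \<open>s\<close> satisfies
  \<open>\<delta> A\<^sub>+ = A\<^sub>+ + A\<^sub>-\<close> (\<open>coboundary_alt_cochain\<close>), and \<open>A\<^sub>- = A\<^sub>+ \<circ> T\<close> on small simplices.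
  Hence \<open>A\<^sub>+ + A\<^sub>-\<close> has the same value on \<open>b\<^bsub>i+1\<^esub>\<close> as on \<open>b\<^sub>i\<close>. On the point \<open>b\<^sub>0\<close> that value is 1,
  so \<open>b\<^sub>n\<close> contains an alternating simplex.
\<close>

section \<open>Chains modulo 2\<close>

\<comment> \<open>The simplifier would otherwise turn sums of bits into exclusive disjunctions.\<close>
declare add_bit_eq_xor [simp del]

primrec facets :: "'a list \<Rightarrow> 'a list list" where
  "facets [] = []"
| "facets (x # xs) = xs # map ((#) x) (facets xs)"

definition chain_sum :: "('a list \<Rightarrow> bit) \<Rightarrow> 'a list list \<Rightarrow> bit" where
  "chain_sum \<phi> c = sum_list (map \<phi> c)"

definition coboundary :: "('a list \<Rightarrow> bit) \<Rightarrow> 'a list \<Rightarrow> bit" where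
  "coboundary \<phi> w = chain_sum \<phi> (facets w)"

lemma bit_double [simp]: "x + x = (0::bit)" "x + (x + y) = (y::bit)"
  by (cases x; cases y; simp)+

lemma chain_sum_Nil [simp]: "chain_sum \<phi> [] = 0"
  and chain_sum_Cons [simp]: "chain_sum \<phi> (w # c) = \<phi> w + chain_sum \<phi> c"
  and chain_sum_append [simp]: "chain_sum \<phi> (c @ c') = chain_sum \<phi> c + chain_sum \<phi> c'"
  and chain_sum_add: "chain_sum (\<lambda>w. \<phi> w + \<psi> w) c = chain_sum \<phi> c + chain_sum \<psi> c"
  and chain_sum_zero [simp]: "chain_sum (\<lambda>w. 0) c = 0"
  by (induction c; simp add: chain_sum_def add_ac comp_def)+

lemma chain_sum_map: "chain_sum \<phi> (map f c) = chain_sum (\<lambda>w. \<phi> (f w)) c"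
  by (simp add: chain_sum_def comp_def)

lemma chain_sum_concat_map:
  "chain_sum \<phi> (concat (map g c)) = chain_sum (\<lambda>w. chain_sum \<phi> (g w)) c"
  by (induction c) simp_all

lemma chain_sum_cong:
  "(\<And>w. w \<in> set c \<Longrightarrow> \<phi> w = \<psi> w) \<Longrightarrow> chain_sum \<phi> c = chain_sum \<psi> c"
  by (simp add: chain_sum_def cong: map_cong)

lemma coboundary_Cons [simp]:
  "coboundary \<phi> (x # w) = \<phi> w + coboundary (\<lambda>u. \<phi> (x # u)) w"
  by (simp add: coboundary_def chain_sum_map)

lemma coboundary_cong: "(\<And>u. \<phi> u = \<psi> u) \<Longrightarrow> coboundary \<phi> w = coboundary \<psi> w"
  by (simp add: coboundary_def cong: chain_sum_cong)

lemma coboundary_Nil [simp]: "coboundary \<phi> [] = 0"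
  by (simp add: coboundary_def)

lemma coboundary_add:
  "coboundary (\<lambda>w. \<phi> w + \<psi> w) = (\<lambda>u. coboundary \<phi> u + coboundary \<psi> u)"
  by (simp add: fun_eq_iff coboundary_def chain_sum_add)

lemma coboundary_coboundary [simp]: "coboundary (coboundary \<phi>) w = 0"
  by (induction w arbitrary: \<phi>) (simp_all add: coboundary_add)

lemma facets_map: "facets (map f w) = map (map f) (facets w)"
  by (induction w) simp_all

lemma coboundary_map: "coboundary \<phi> (map f w) = coboundary (\<lambda>u. \<phi> (map f u)) w"
  by (simp add: coboundary_def facets_map chain_sum_map)

lemma facets_length: "w' \<in> set (facets w) \<Longrightarrow> length w = Suc (length w')"
  by (induction w arbitrary: w') auto

lemma facets_subset: "w' \<in> set (facets w) \<Longrightarrow> set w' \<subseteq> set w"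
  by (induction w arbitrary: w') (auto, blast+)

section \<open>Alternating labels\<close>

primrec alternates :: "bool \<Rightarrow> bool list \<Rightarrow> bool" where
  "alternates s [] = True"
| "alternates s (x # xs) = (x = s \<and> alternates (\<not> s) xs)"

text \<open>
  The combinatorial core of Fan's lemma. Deleting an entry of a sign word can leave an alternating
  word only if the word alternates already and an end is deleted, or if two neighbours are equal
  and one of them is deleted. In the second case there are two such deletions, which cancel.
\<close>

lemma coboundary_alternates:
  "coboundary (\<lambda>v. of_bool (alternates s v)) v =
     of_bool (alternates s v) + of_bool (alternates (\<not> s) v)"
proof (induction v arbitrary: s)
  case (Cons x v)
  have "coboundary (\<lambda>v. of_bool (alternates s (x # v))) v =
      (if x = s then coboundary (\<lambda>v. of_bool (alternates (\<not> s) v)) v else 0)"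
    by (simp add: coboundary_def)
  with Cons show ?case by (auto simp: add_ac)
qed simp

lemma facets_mset: "mset (map mset (facets w)) = image_mset (\<lambda>x. mset w - {#x#}) (mset w)"
proof (induction w)
  case (Cons x w)
  have "image_mset (\<lambda>M. add_mset x M) (image_mset (\<lambda>y. mset w - {#y#}) (mset w)) =
        image_mset (\<lambda>y. add_mset x (mset w) - {#y#}) (mset w)"
    unfolding multiset.map_comp by (rule image_mset_cong) auto
  moreover have "mset (map mset (map ((#) x) (facets w))) =
      image_mset (\<lambda>M. add_mset x M) (mset (map mset (facets w)))"
    by (simp add: multiset.map_comp comp_def)
  ultimately show ?case using Cons by simp
qed simp

text \<open>
  Reordering the vertices permutes the facets up to order, so labels may be sorted before facets
  are taken.
\<close>

lemma coboundary_permute: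
  assumes "mset w = mset v"
  shows "coboundary (\<lambda>u. \<phi> (mset u)) w = coboundary (\<lambda>u. \<phi> (mset u)) v"
proof -
  have "coboundary (\<lambda>u. \<phi> (mset u)) w = sum_mset (image_mset \<phi> (mset (map mset (facets w))))" for w :: "'a list"
    by (simp add: coboundary_def chain_sum_def multiset.map_comp comp_def sum_mset_sum_list[symmetric])
  with assms show ?thesis by (simp only: facets_mset)
qed

lemma facets_sorted: "w' \<in> set (facets w) \<Longrightarrow> sorted w \<Longrightarrow> sorted w'"
proof (induction w arbitrary: w')
  case (Cons x w)
  then show ?case using facets_subset by fastforce
qed simp

text \<open>
  The order compares magnitudes first. Ties are broken by the sign only to have a linear order, so
  that the sorted list of labels depends on the multiset of labels alone.
\<close>

datatype label = Label (magnitude: real) (positive: bool)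

instantiation label :: linorder
begin

definition less_eq_label :: "label \<Rightarrow> label \<Rightarrow> bool" where
  "less_eq_label p q \<longleftrightarrow> magnitude p < magnitude q \<or>
     magnitude p = magnitude q \<and> (positive p \<longrightarrow> positive q)"

definition less_label :: "label \<Rightarrow> label \<Rightarrow> bool" where
  "less_label p q \<longleftrightarrow> p \<le> q \<and> \<not> q \<le> p"

instance
  by standard (auto simp: less_eq_label_def less_label_def intro: label.expand)

end

definition sorted_signs :: "label list \<Rightarrow> bool list" where
  "sorted_signs L = map positive (sort L)"

definition alt_cochain :: "bool \<Rightarrow> label list \<Rightarrow> bit" where
  "alt_cochain s L = of_bool (alternates s (sorted_signs L))"

lemma coboundary_alt_cochain:
  "coboundary (alt_cochain s) L = alt_cochain s L + alt_cochain (\<not> s) L"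
proof -
  define \<phi> where "\<phi> M = (of_bool (alternates s (map positive (sorted_list_of_multiset M))) :: bit)" for M
  have eq: "alt_cochain s = (\<lambda>u. \<phi> (mset u))"
    by (simp add: fun_eq_iff \<phi>_def alt_cochain_def sorted_signs_def)
  have "coboundary (alt_cochain s) L = coboundary (alt_cochain s) (sort L)"
    unfolding eq by (rule coboundary_permute) simp
  also have "\<dots> = coboundary (\<lambda>u. of_bool (alternates s (map positive u))) (sort L)"
    unfolding coboundary_def
    by (rule chain_sum_cong)
      (auto simp: alt_cochain_def sorted_signs_def sorted_sort_id dest: facets_sorted)
  also have "\<dots> = coboundary (\<lambda>u. of_bool (alternates s u)) (sorted_signs L)"
    by (simp add: coboundary_map sorted_signs_def)
  finally show ?thesis by (simp add: coboundary_alternates alt_cochain_def)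
qed

lemma alternates_Not: "alternates s (map Not v) = alternates (\<not> s) v"
  by (induction v arbitrary: s) auto

definition flip :: "label \<Rightarrow> label" where
  "flip p = Label (magnitude p) (\<not> positive p)"

text \<open>
  Without complementary pairs no tie between magnitudes is broken by the sign, so flipping all
  signs does not disturb the sorted order.
\<close>

lemma alt_cochain_flip:
  assumes "\<And>p. p \<in> set L \<Longrightarrow> flip p \<notin> set L"
  shows "alt_cochain s (map flip L) = alt_cochain (\<not> s) L"
proof -
  have "sorted_wrt (\<lambda>p q. flip p \<le> flip q) (sort L)"
  proof (rule sorted_wrt_mono_rel)
    show "sorted_wrt (\<le>) (sort L)" by simp
    fix p q assume pq: "p \<in> set (sort L)" "q \<in> set (sort L)" "p \<le> q"
    then have "flip q \<noteq> p" using assms[of q] by auto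
    with pq(3) show "flip p \<le> flip q"
      by (cases p; cases q) (auto simp: flip_def less_eq_label_def)
  qed
  then have "sort (map flip L) = map flip (sort L)"
    by (intro properties_for_sort) (simp_all add: sorted_wrt_map)
  then have "sorted_signs (map flip L) = map Not (sorted_signs L)"
    by (simp add: sorted_signs_def comp_def flip_def)
  then show ?thesis by (simp add: alt_cochain_def alternates_Not)
qed

section \<open>Barycentric subdivision\<close>

definition barycentre :: "'a::real_vector list \<Rightarrow> 'a" where
  "barycentre w = (1 / length w) *\<^sub>R sum_list w"

text \<open>
  The cone from the barycentre over the subdivided boundary. The empty simplex counts as a simplex
  of dimension \<open>-1\<close> (the augmented chain complex), so that vertices need no separate clause.
\<close>

function subdivide :: "'a::real_vector list \<Rightarrow> 'a list list" where
  "subdivide w = (if w = [] then [[]]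
     else map ((#) (barycentre w)) (concat (map subdivide (facets w))))"
  by auto
termination
  by (relation "Wellfounded.measure length") (auto dest: facets_length)
declare subdivide.simps [simp del]

lemma subdivide_Nil [simp]: "subdivide [] = [[]]"
  by (simp add: subdivide.simps)

lemma chain_sum_subdivide:
  "w \<noteq> [] \<Longrightarrow> chain_sum \<phi> (subdivide w) =
    coboundary (\<lambda>w'. chain_sum (\<lambda>u. \<phi> (barycentre w # u)) (subdivide w')) w"
  by (subst subdivide.simps) (simp add: chain_sum_map chain_sum_concat_map coboundary_def)

text \<open>
  Subdivision commutes with the boundary. The facet of a cone opposite its apex contributes the
  subdivided boundary, and the remaining facets form a cone over a subdivided double boundary,
  which vanishes.
\<close>

lemma subdivide_chain_map:
  "chain_sum (coboundary \<phi>) (subdivide w) = coboundary (\<lambda>u. chain_sum \<phi> (subdivide u)) w"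
proof (induction "length w" arbitrary: w \<phi> rule: less_induct)
  case less
  show ?case
  proof (cases "w = []")
    case False
    let ?\<psi> = "\<lambda>u. \<phi> (barycentre w # u)"
    have "chain_sum (coboundary \<phi>) (subdivide w) =
        coboundary (\<lambda>w'. chain_sum \<phi> (subdivide w') + chain_sum (coboundary ?\<psi>) (subdivide w')) w"
      using False by (simp add: chain_sum_subdivide chain_sum_add)
    also have "\<dots> = coboundary (\<lambda>w'. chain_sum \<phi> (subdivide w')) w +
        coboundary (\<lambda>w'. chain_sum (coboundary ?\<psi>) (subdivide w')) w"
      by (simp only: coboundary_add)
    also have "coboundary (\<lambda>w'. chain_sum (coboundary ?\<psi>) (subdivide w')) w =
        coboundary (coboundary (\<lambda>u. chain_sum ?\<psi> (subdivide u))) w"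
      unfolding coboundary_def[of _ w]
      by (rule chain_sum_cong) (use less facets_length in fastforce)
    finally show ?thesis by simp
  qed simp
qed

lemma barycentre_uminus: "barycentre (map uminus w) = - barycentre w"
proof -
  have "sum_list (map uminus w) = - sum_list w" for w :: "'a list"
    by (induction w) simp_all
  then show ?thesis by (simp add: barycentre_def)
qed

lemma subdivide_uminus: "subdivide (map uminus w) = map (map uminus) (subdivide w)"
proof (induction "length w" arbitrary: w rule: less_induct)
  case less
  show ?case
  proof (cases "w = []")
    case False
    have IH: "subdivide (map uminus w') = map (map uminus) (subdivide w')" if "w' \<in> set (facets w)" for w'
      using less that facets_length by fastforce
    with False show ?thesis
      by (simp add: subdivide.simps[of w] subdivide.simps[of "map uminus w"] facets_map
          barycentre_uminus map_concat comp_def IH cong: map_cong)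
  qed simp
qed

lemma subdivide_length: "u \<in> set (subdivide w) \<Longrightarrow> length u = length w"
proof (induction "length w" arbitrary: w u rule: less_induct)
  case less
  show ?case
  proof (cases "w = []")
    case False
    with less.prems obtain w' u' where "w' \<in> set (facets w)" "u' \<in> set (subdivide w')" "u = barycentre w # u'"
      by (auto simp: subdivide.simps[of w])
    with less.hyps[of w' u'] facets_length[of w' w] show ?thesis by auto
  qed (use less in simp)
qed

lemma barycentre_in_hull:
  assumes "w \<noteq> []"
  shows "barycentre w \<in> convex hull (set w)"
proof -
  have "(\<Sum>i<length w. (1 / length w) *\<^sub>R w ! i) \<in> convex hull (set w)"
    using assms by (intro convex_sum) (auto intro: hull_inc)
  then show ?thesis
    by (simp add: barycentre_def sum_list_sum_nth scaleR_sum_right atLeast0LessThan)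
qed

lemma subdivide_hull: "u \<in> set (subdivide w) \<Longrightarrow> set u \<subseteq> convex hull (set w)"
proof (induction "length w" arbitrary: w u rule: less_induct)
  case less
  show ?case
  proof (cases "w = []")
    case False
    with less.prems obtain w' u' where w': "w' \<in> set (facets w)" and u': "u' \<in> set (subdivide w')"
      and u: "u = barycentre w # u'"
      by (auto simp: subdivide.simps[of w])
    have "set u' \<subseteq> convex hull (set w')" using less.hyps[of w' u'] w' u' facets_length[of w' w] by auto
    also have "\<dots> \<subseteq> convex hull (set w)" by (intro hull_mono facets_subset w')
    finally show ?thesis using barycentre_in_hull[OF False] u by simp
  qed (use less in simp)
qed

text \<open>
  One of the averaged differences is zero, which gives the factor \<open>(l - 1) / l\<close> for a simplex with
  \<open>l\<close> vertices.
\<close>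

lemma dist_barycentre:
  fixes w :: "'a::real_normed_vector list"
  assumes v: "v \<in> set w" and d: "\<And>x y. x \<in> set w \<Longrightarrow> y \<in> set w \<Longrightarrow> dist x y \<le> d"
  shows "dist (barycentre w) v \<le> (real (length w - 1) / real (length w)) * d"
proof -
  have L: "length w > 0" using v by auto
  have "sum_list (map (\<lambda>y. y - v) w) = sum_list w - real (length w) *\<^sub>R v" for w :: "'a list"
    by (induction w) (simp_all add: algebra_simps)
  then have "barycentre w - v = (1 / length w) *\<^sub>R sum_list (map (\<lambda>y. y - v) w)"
    using L by (simp add: barycentre_def scaleR_diff_right)
  also have "sum_list (map (\<lambda>y. y - v) w) = sum_list (map (\<lambda>y. y - v) (remove1 v w))"
    using sum_list_map_remove1[OF v, of "\<lambda>y. y - v"] by simp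
  finally have eq: "dist (barycentre w) v = norm (sum_list (map (\<lambda>y. y - v) (remove1 v w))) / length w"
    by (simp add: dist_norm divide_inverse mult.commute)
  have "norm (sum_list (map (\<lambda>y. y - v) w')) \<le> length w' * d" if "set w' \<subseteq> set w" for w'
    using that
  proof (induction w')
    case (Cons a w')
    have "norm (a - v) \<le> d" using d[of a v] Cons.prems v by (simp add: dist_norm)
    with Cons norm_triangle_ineq[of "a - v" "sum_list (map (\<lambda>y. y - v) w')"] show ?case
      by (simp add: algebra_simps)
  qed simp
  from this[of "remove1 v w"] have "norm (sum_list (map (\<lambda>y. y - v) (remove1 v w))) \<le> real (length w - 1) * d"
    using v set_remove1_subset[of v w] by (simp add: length_remove1)
  then have "norm (sum_list (map (\<lambda>y. y - v) (remove1 v w))) / length w \<le> real (length w - 1) * d / length w"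
    by (rule divide_right_mono) simp
  then show ?thesis unfolding eq by simp
qed

text \<open>
  Pairs that involve the new barycentre are controlled by \<open>dist_barycentre\<close>, extended to the convex
  hull because balls are convex; all other pairs lie in a subdivided facet. The factor depends
  only on a bound for the dimension, so that it can be iterated.
\<close>

lemma subdivide_shrinks:
  fixes w :: "'a::real_normed_vector list"
  assumes "u \<in> set (subdivide w)" "length w \<le> Suc m" "0 \<le> d"
    and "\<And>x y. x \<in> set w \<Longrightarrow> y \<in> set w \<Longrightarrow> dist x y \<le> d"
    and "x \<in> set u" "y \<in> set u"
  shows "dist x y \<le> real m / real (Suc m) * d"
  using assms
proof (induction "length w" arbitrary: w u x y rule: less_induct)
  case less
  have "w \<noteq> []" using less.prems by auto
  with less.prems obtain w' u' where w': "w' \<in> set (facets w)" and u': "u' \<in> set (subdivide w')"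
      and u: "u = barycentre w # u'"
      by (auto simp: subdivide.simps[of w])
  let ?b = "barycentre w" and ?r = "real m / real (Suc m) * d"
  have sub: "set w' \<subseteq> set w" using facets_subset w' by blast
  have inner: "dist x y \<le> ?r" if "x \<in> set u'" "y \<in> set u'" for x y
    by (rule less.hyps[OF _ u']) (use that w' less.prems sub facets_length[OF w'] in auto)
  have "real (length w - 1) / real (length w) \<le> real m / real (Suc m)"
  proof -
    have "real (length w - 1) * real (Suc m) \<le> real m * real (length w)"
      using \<open>w \<noteq> []\<close> less.prems(2) by (cases w) (auto simp: algebra_simps)
    then show ?thesis using \<open>w \<noteq> []\<close> by (simp add: divide_simps)
  qed
  then have "real (length w - 1) / real (length w) * d \<le> ?r"
    using less.prems(3) by (rule mult_right_mono)
  then have "dist ?b v \<le> ?r" if "v \<in> set w" for v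
    using dist_barycentre[OF that less.prems(4)] by linarith
  then have "set w \<subseteq> cball ?b ?r" by auto
  then have "convex hull (set w) \<subseteq> cball ?b ?r"
    by (intro hull_minimal) auto
  moreover have "set u' \<subseteq> convex hull (set w)"
    using subdivide_hull[OF u'] hull_mono[OF sub, of convex] by blast
  ultimately have outer: "dist ?b y \<le> ?r" if "y \<in> set u'" for y
    using that by auto
  show ?case using less.prems(3,5,6) inner outer unfolding u
    by (auto simp: dist_commute)
qed


definition subdivide_chain :: "'a::real_vector list list \<Rightarrow> 'a list list" where
  "subdivide_chain c = concat (map subdivide c)"

lemma chain_sum_subdivide_chain:
  "chain_sum \<phi> (subdivide_chain c) = chain_sum (\<lambda>w. chain_sum \<phi> (subdivide w)) c"
  by (simp add: subdivide_chain_def chain_sum_concat_map)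

lemma iterated_subdivision_shrinks:
  fixes c :: "'a::real_normed_vector list list"
  assumes "w \<in> set ((subdivide_chain ^^ k) c)" "\<And>v. v \<in> set c \<Longrightarrow> length v \<le> Suc m"
    and "\<And>v x y. v \<in> set c \<Longrightarrow> x \<in> set v \<Longrightarrow> y \<in> set v \<Longrightarrow> dist x y \<le> d" "0 \<le> d"
  shows "\<exists>v\<in>set c. length w = length v \<and> set w \<subseteq> convex hull (set v) \<and>
      (\<forall>x\<in>set w. \<forall>y\<in>set w. dist x y \<le> (real m / real (Suc m)) ^ k * d)"
  using assms(1)
proof (induction k arbitrary: w)
  case 0
  with assms(3) show ?case by (auto intro!: bexI[of _ w] hull_inc)
next
  case (Suc k)
  then obtain u where u: "u \<in> set ((subdivide_chain ^^ k) c)" "w \<in> set (subdivide u)"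
    by (auto simp: subdivide_chain_def[of "(subdivide_chain ^^ k) c"])
  from Suc.IH[OF u(1)] obtain v where v: "v \<in> set c" "length u = length v" "set u \<subseteq> convex hull (set v)"
    and d: "\<And>x y. x \<in> set u \<Longrightarrow> y \<in> set u \<Longrightarrow> dist x y \<le> (real m / real (Suc m)) ^ k * d"
    by blast
  have "dist x y \<le> real m / real (Suc m) * ((real m / real (Suc m)) ^ k * d)"
    if "x \<in> set w" "y \<in> set w" for x y
    by (rule subdivide_shrinks[OF u(2)]) (use assms v d that in auto)
  moreover have "set w \<subseteq> convex hull (set v)"
    using subdivide_hull[OF u(2)] v(3) by (meson convex_convex_hull hull_minimal order_trans)
  moreover have "length w = length v" using subdivide_length[OF u(2)] v(2) by simp
  ultimately show ?case using v(1) by (auto simp: mult.assoc)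
qed

section \<open>Antipodal hemispheres of the cross-polytope\<close>

text \<open>
  The relation \<open>\<partial> c = b + T b\<close> for the antipodal map \<open>T\<close>, expressed through its pairing with all
  cochains.
\<close>

definition antipodal_boundary :: "'a::real_vector list list \<Rightarrow> 'a list list \<Rightarrow> bool" where
  "antipodal_boundary c b \<longleftrightarrow>
     (\<forall>\<phi>. chain_sum (coboundary \<phi>) c = chain_sum (\<lambda>w. \<phi> w + \<phi> (map uminus w)) b)"

lemma antipodal_boundary_subdivide:
  assumes "antipodal_boundary c b"
  shows "antipodal_boundary (subdivide_chain c) (subdivide_chain b)"
proof -
  have "chain_sum (coboundary \<phi>) (subdivide_chain c) =
      chain_sum (\<lambda>w. \<phi> w + \<phi> (map uminus w)) (subdivide_chain b)" for \<phi>
    using assms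
    by (simp add: antipodal_boundary_def chain_sum_subdivide_chain subdivide_chain_map
        subdivide_uminus chain_sum_map chain_sum_add)
  then show ?thesis by (simp add: antipodal_boundary_def)
qed

text \<open>
  The facets, containing \<open>+e\<^sub>i\<close>, of the cross-polytope with vertices \<open>\<plusminus>e\<^sub>0, \<dots>, \<plusminus>e\<^sub>i\<close>.
\<close>

primrec hemisphere :: "(nat \<Rightarrow> 'a::real_vector) \<Rightarrow> nat \<Rightarrow> 'a list list" where
  "hemisphere e 0 = [[e 0]]"
| "hemisphere e (Suc i) =
     map ((#) (e (Suc i))) (hemisphere e i @ map (map uminus) (hemisphere e i))"

text \<open>
  The boundary of a cone over a cycle is that cycle, and \<open>b + T b\<close> is a cycle: if
  \<open>\<partial> b = b' + T b'\<close>, then applying \<open>T\<close> gives the same chain, and the two copies cancel.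
\<close>

lemma antipodal_boundary_hemisphere: "antipodal_boundary (hemisphere e (Suc i)) (hemisphere e i)"
proof (induction i)
  case 0
  show ?case by (simp add: antipodal_boundary_def add_ac)
next
  case (Suc i)
  let ?b = "hemisphere e (Suc i)"
  have "chain_sum (coboundary \<phi>) (hemisphere e (Suc (Suc i))) =
      chain_sum (\<lambda>w. \<phi> w + \<phi> (map uminus w)) ?b" for \<phi>
  proof -
    let ?\<psi> = "\<lambda>w. \<phi> (e (Suc (Suc i)) # w)"
    have "chain_sum (coboundary \<phi>) (hemisphere e (Suc (Suc i))) =
        chain_sum (\<lambda>w. \<phi> w + \<phi> (map uminus w)) ?b +
        chain_sum (coboundary (\<lambda>w. ?\<psi> w + ?\<psi> (map uminus w))) ?b"
      by (simp add: hemisphere.simps(2)[of e "Suc i"] chain_sum_map chain_sum_add coboundary_add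
          coboundary_map add_ac del: hemisphere.simps)
    also have "chain_sum (coboundary (\<lambda>w. ?\<psi> w + ?\<psi> (map uminus w))) ?b = 0"
      using Suc unfolding antipodal_boundary_def by (simp add: comp_def add_ac del: hemisphere.simps)
    finally show ?thesis by simp
  qed
  then show ?case by (simp add: antipodal_boundary_def del: hemisphere.simps)
qed

text \<open>
  The vector \<open>u\<close>, a signed sum of basis vectors, describes a hyperplane \<open>u \<bullet> x = 1\<close> that contains the
  face. It keeps the convex hull of the face away from the origin, quantitatively through the bound
  on \<open>norm u\<close>. The orthogonality to later \<open>e j\<close> is what the induction needs to add the next vertex.
\<close>

lemma hemisphere_simplex:
  fixes e :: "nat \<Rightarrow> 'a::real_inner"
  assumes orth: "\<And>i j. i \<le> n \<Longrightarrow> j \<le> n \<Longrightarrow> e i \<bullet> e j = of_bool (i = j)"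
    and "w \<in> set (hemisphere e i)" "i \<le> n"
  shows "length w = Suc i \<and> (\<forall>x\<in>set w. norm x = 1 \<and> (\<forall>j. i < j \<and> j \<le> n \<longrightarrow> x \<bullet> e j = 0)) \<and>
    (\<exists>u. norm u \<le> real (Suc i) \<and> (\<forall>j. i < j \<and> j \<le> n \<longrightarrow> u \<bullet> e j = 0) \<and> (\<forall>x\<in>set w. u \<bullet> x = 1))"
  using assms(2,3)
proof (induction i arbitrary: w)
  case 0
  then show ?case using orth by (auto simp: norm_eq_1 norm_eq_sqrt_inner intro!: exI[of _ "e 0"])
next
  case (Suc i)
  let ?f = "e (Suc i)"
  have f: "norm ?f = 1" using orth Suc.prems by (simp add: norm_eq_sqrt_inner)
  from Suc.prems obtain v where v: "v \<in> set (hemisphere e i)" and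
    w: "w = ?f # v \<or> w = ?f # map uminus v" by auto
  from Suc.IH[OF v] Suc.prems obtain u where IH: "length v = Suc i"
    "\<And>x. x \<in> set v \<Longrightarrow> norm x = 1"
    "\<And>x j. x \<in> set v \<Longrightarrow> i < j \<Longrightarrow> j \<le> n \<Longrightarrow> x \<bullet> e j = 0"
    and u: "norm u \<le> real (Suc i)" "\<And>j. i < j \<Longrightarrow> j \<le> n \<Longrightarrow> u \<bullet> e j = 0" "\<And>x. x \<in> set v \<Longrightarrow> u \<bullet> x = 1"
    by auto
  obtain \<sigma> :: real where \<sigma>: "\<bar>\<sigma>\<bar> = 1" "w = ?f # map (\<lambda>x. \<sigma> *\<^sub>R x) v"
  proof (cases "w = ?f # v")
    case True
    then show thesis by (intro that[of 1]) auto
  next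
    case False
    with w show thesis by (intro that[of "-1"]) auto
  qed
  define u' where "u' = ?f + \<sigma> *\<^sub>R u"
  have \<sigma>2: "\<sigma> * \<sigma> = 1"
    using \<sigma>(1) by (metis abs_mult_self_eq mult_1)
  have ff: "?f \<bullet> ?f = 1" using orth Suc.prems by simp
  have uf: "u \<bullet> ?f = 0" using u(2)[of "Suc i"] Suc.prems by simp
  have fv: "?f \<bullet> y = 0" if "y \<in> set v" for y
    using IH(3)[OF that, of "Suc i"] Suc.prems by (simp add: inner_commute)
  have "norm u' \<le> real (Suc (Suc i))"
    using norm_triangle_ineq[of ?f "\<sigma> *\<^sub>R u"] f u(1) \<sigma>(1) by (simp add: u'_def)
  moreover have "u' \<bullet> e j = 0" if "Suc i < j" "j \<le> n" for j
    using u(2)[of j] orth[of "Suc i" j] that by (simp add: u'_def inner_add_left)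
  moreover have "u' \<bullet> x = 1" if "x \<in> set w" for x
    using that \<sigma>(2) u(3) fv uf ff by (auto simp: u'_def inner_add_left \<sigma>2)
  moreover have "length w = Suc (Suc i)" using \<sigma>(2) IH(1) by simp
  moreover have "norm x = 1 \<and> (\<forall>j. Suc i < j \<and> j \<le> n \<longrightarrow> x \<bullet> e j = 0)" if "x \<in> set w" for x
    using that \<sigma> f IH(2,3) orth Suc.prems by auto
  ultimately show ?case by blast
qed

section \<open>Fan's lemma for labellings of the sphere\<close>

text \<open>
  Controls how the radial projection to the sphere enlarges small simplices.
\<close>

lemma dist_sgn_le:
  fixes x y :: "'a::real_normed_vector"
  assumes "x \<noteq> 0" "y \<noteq> 0"
  shows "dist (sgn x) (sgn y) \<le> 2 * dist x y / norm x"
proof -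
  have nx: "norm x > 0" and ny: "norm y > 0" using assms by auto
  have eq: "sgn x - sgn y = (1 / norm x) *\<^sub>R (x - y) + ((norm y - norm x) / (norm x * norm y)) *\<^sub>R y"
    using nx ny by (simp add: sgn_div_norm diff_divide_distrib algebra_simps inverse_eq_divide)
  have "norm (sgn x - sgn y) \<le> norm (x - y) / norm x + \<bar>norm y - norm x\<bar> / norm x"
    unfolding eq using nx ny by (intro norm_triangle_le) (simp add: abs_mult)
  also have "\<dots> \<le> norm (x - y) / norm x + norm (x - y) / norm x"
    using nx norm_triangle_ineq3[of y x] by (intro add_left_mono divide_right_mono) (auto simp: norm_minus_commute)
  finally show ?thesis by (simp add: dist_norm)
qed

text \<open>
  Ky Fan's lemma, stated for the sphere itself instead of a triangulation. The labelling is read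
  off at the radial projections of the vertices of a subdivided cross-polytope.
\<close>

theorem alternating_simplex:
  fixes \<L> :: "'a::euclidean_space \<Rightarrow> label"
  assumes dim: "DIM('a) = Suc n" and \<epsilon>: "\<epsilon> > 0"
    and odd: "\<And>x. x \<in> sphere 0 1 \<Longrightarrow> \<L> (- x) = flip (\<L> x)"
    and near: "\<And>x y. x \<in> sphere 0 1 \<Longrightarrow> y \<in> sphere 0 1 \<Longrightarrow> dist x y < \<epsilon> \<Longrightarrow> \<L> y \<noteq> flip (\<L> x)"
  obtains w s where "length w = Suc n" "set w \<subseteq> sphere 0 1"
    "\<And>x y. x \<in> set w \<Longrightarrow> y \<in> set w \<Longrightarrow> dist x y < \<epsilon>"
    "alternates s (sorted_signs (map \<L> w))"
proof -
  obtain e :: "nat \<Rightarrow> 'a" where e: "bij_betw e {0..<Suc n} Basis"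
    using ex_bij_betw_nat_finite[of "Basis :: 'a set"] dim by auto
  have orth: "e i \<bullet> e j = of_bool (i = j)" if "i \<le> n" "j \<le> n" for i j
  proof -
    have "e i \<in> Basis" "e j \<in> Basis" using e that by (auto simp: bij_betw_def)
    moreover have "e i = e j \<longleftrightarrow> i = j"
      using bij_betw_imp_inj_on[OF e] that by (intro inj_on_eq_iff) auto
    ultimately show ?thesis by (simp add: inner_Basis)
  qed
  \<comment> \<open>The faces have diameter at most 2, and all points in them have norm at least \<open>1 / (n + 1)\<close>,
    so that projecting costs a factor \<open>2 (n + 1)\<close>.\<close>
  obtain k where k: "(real n / real (Suc n)) ^ k < \<epsilon> / (4 * real (Suc n))"
    using real_arch_pow_inv[of "\<epsilon> / (4 * real (Suc n))" "real n / real (Suc n)"] \<epsilon> by auto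
  define H where "H i = (subdivide_chain ^^ k) (hemisphere e i)" for i
  have fine: "length w = Suc i \<and> 0 \<notin> set w \<and> (\<forall>x\<in>set w. \<forall>y\<in>set w. dist (sgn x) (sgn y) < \<epsilon>)"
    if w: "w \<in> set (H i)" and i: "i \<le> n" for w i
  proof -
    note S = hemisphere_simplex[OF orth _ i]
    have "dist x y \<le> 2" if "v \<in> set (hemisphere e i)" "x \<in> set v" "y \<in> set v" for v x y
      using S[OF _ _ that(1)] that(2,3) norm_triangle_ineq4[of x y] by (force simp: dist_norm)
    with iterated_subdivision_shrinks[of w k "hemisphere e i" n 2] w S i
    obtain v where v: "v \<in> set (hemisphere e i)" "length w = length v" "set w \<subseteq> convex hull (set v)"
      and d: "\<And>x y. x \<in> set w \<Longrightarrow> y \<in> set w \<Longrightarrow> dist x y \<le> (real n / real (Suc n)) ^ k * 2"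
      unfolding H_def by force
    from S[OF _ _ v(1)] obtain u where len: "length v = Suc i" and u: "norm u \<le> real (Suc i)" "\<And>x. x \<in> set v \<Longrightarrow> u \<bullet> x = 1"
      by auto
    have "convex hull (set v) \<subseteq> {x. u \<bullet> x = 1}"
      using u by (intro hull_minimal convex_hyperplane) auto
    with v have ux: "u \<bullet> x = 1" if "x \<in> set w" for x using that by auto
    have norm: "1 \<le> real (Suc n) * norm x" if "x \<in> set w" for x
    proof -
      have "1 \<le> norm u * norm x" using Cauchy_Schwarz_ineq2[of u x] ux[OF that] by simp
      also have "\<dots> \<le> real (Suc n) * norm x" using u(1) i by (intro mult_right_mono) auto
      finally show ?thesis .
    qed
    have nz: "0 \<notin> set w" using norm by force
    have "dist (sgn x) (sgn y) < \<epsilon>" if "x \<in> set w" "y \<in> set w" for x y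
    proof -
      have "dist (sgn x) (sgn y) \<le> 2 * dist x y / norm x" using that nz by (intro dist_sgn_le) auto
      also have "\<dots> \<le> 2 * dist x y * real (Suc n)"
      proof -
        have "norm x > 0" using that nz by auto
        then have "1 / norm x \<le> real (Suc n)" using norm[OF that(1)] by (simp add: divide_simps)
        from mult_left_mono[OF this, of "2 * dist x y"] show ?thesis by simp
      qed
      also have "\<dots> \<le> 2 * ((real n / real (Suc n)) ^ k * 2) * real (Suc n)"
        using d[OF that] by (intro mult_right_mono mult_left_mono) auto
      also have "\<dots> < \<epsilon>" using k by (simp add: field_simps)
      finally show ?thesis .
    qed
    with nz len v show ?thesis by auto
  qed
  define \<phi> where "\<phi> s w = alt_cochain s (map (\<lambda>x. \<L> (sgn x)) w)" for s w
  have \<phi>_uminus: "\<phi> s (map uminus w) = \<phi> (\<not> s) w" if "w \<in> set (H i)" "i \<le> n" for s w i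
  proof -
    have sph: "sgn x \<in> sphere 0 1" if "x \<in> set w" for x
      using that fine[OF \<open>w \<in> set (H i)\<close> \<open>i \<le> n\<close>] by (auto simp: norm_sgn)
    have "map (\<lambda>x. \<L> (sgn x)) (map uminus w) = map flip (map (\<lambda>x. \<L> (sgn x)) w)"
      using odd sph by (simp add: sgn_minus)
    moreover have "flip p \<notin> set (map (\<lambda>x. \<L> (sgn x)) w)" if "p \<in> set (map (\<lambda>x. \<L> (sgn x)) w)" for p
      using that near[OF sph sph] fine[OF \<open>w \<in> set (H i)\<close> \<open>i \<le> n\<close>] by force
    then have "alt_cochain s (map flip (map (\<lambda>x. \<L> (sgn x)) w)) = alt_cochain (\<not> s) (map (\<lambda>x. \<L> (sgn x)) w)"
      by (rule alt_cochain_flip)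
    ultimately show ?thesis by (simp only: \<phi>_def)
  qed
  have \<phi>_coboundary: "coboundary (\<phi> s) = (\<lambda>w. \<phi> s w + \<phi> (\<not> s) w)" for s
    using coboundary_map[of "alt_cochain s" "\<lambda>x. \<L> (sgn x)"] coboundary_alt_cochain
    by (simp add: \<phi>_def fun_eq_iff cong: coboundary_cong)
  have bdry: "antipodal_boundary (H (Suc i)) (H i)" for i
    unfolding H_def by (induction k) (use antipodal_boundary_hemisphere antipodal_boundary_subdivide in auto)
  \<comment> \<open>By \<open>\<phi>_uminus\<close>, the second summand counts the positive alternating simplices of the
    antipodal hemisphere.\<close>
  have odd_count: "chain_sum (\<lambda>w. \<phi> True w + \<phi> False w) (H i) = 1" if "i \<le> n" for i
    using that
  proof (induction i)
    case 0
    have "(subdivide_chain ^^ j) [[e 0]] = [[e 0]]" for j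
      by (induction j) (simp_all add: subdivide_chain_def subdivide.simps[of "[e 0]"] barycentre_def)
    then show ?case by (simp add: H_def \<phi>_def alt_cochain_def sorted_signs_def)
  next
    case (Suc i)
    have "chain_sum (\<lambda>w. \<phi> True w + \<phi> False w) (H (Suc i)) = chain_sum (coboundary (\<phi> True)) (H (Suc i))"
      by (simp add: \<phi>_coboundary)
    also have "\<dots> = chain_sum (\<lambda>w. \<phi> True w + \<phi> True (map uminus w)) (H i)"
      using bdry unfolding antipodal_boundary_def by blast
    also have "\<dots> = chain_sum (\<lambda>w. \<phi> True w + \<phi> False w) (H i)"
      using \<phi>_uminus[of _ i True] Suc.prems by (intro chain_sum_cong) simp
    finally show ?case using Suc by simp
  qed
  have "\<exists>w\<in>set (H n). \<phi> True w \<noteq> 0 \<or> \<phi> False w \<noteq> 0"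
  proof (rule ccontr)
    assume "\<not> ?thesis"
    then have "chain_sum (\<lambda>w. \<phi> True w + \<phi> False w) (H n) = chain_sum (\<lambda>w. 0) (H n)"
      by (intro chain_sum_cong) auto
    with odd_count[of n] show False by simp
  qed
  then obtain w s where w: "w \<in> set (H n)" and "\<phi> s w \<noteq> 0" by blast
  then have "alternates s (sorted_signs (map \<L> (map sgn w)))"
    by (auto simp: \<phi>_def alt_cochain_def comp_def split: if_splits)
  with fine[OF w] show thesis
    by (intro that[of "map sgn w" s]) (auto simp: norm_sgn)
qed


section \<open>Odd maps to the circle\<close>

text \<open>
  A half-open half-circle, containing exactly one point of each antipodal pair of the circle.
\<close>

definition upper_half :: "real ^ 2 \<Rightarrow> bool" where
  "upper_half z \<longleftrightarrow> z $ 2 > 0 \<or> z $ 2 = 0 \<and> z $ 1 > 0"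

text \<open>
  A point is \<open>\<sigma> (cos t, sin t)\<close> with \<open>t\<close> its magnitude and \<open>\<sigma> = \<plusminus>1\<close> its sign, see
  \<open>circle_label_polar\<close>.
\<close>

definition circle_label :: "real ^ 2 \<Rightarrow> label" where
  "circle_label z = Label (arccos (if upper_half z then z $ 1 else - z $ 1)) (upper_half z)"

lemma circle_coords: "z \<in> sphere (0 :: real ^ 2) 1 \<longleftrightarrow> (z $ 1)\<^sup>2 + (z $ 2)\<^sup>2 = 1"
  by (simp add: norm_eq_1 inner_vec_def sum_2 power2_eq_square)

lemma circle_label_uminus:
  assumes "z \<in> sphere 0 1"
  shows "circle_label (- z) = flip (circle_label z)"
proof -
  have "z $ 1 \<noteq> 0 \<or> z $ 2 \<noteq> 0" using assms circle_coords[of z] by auto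
  then have "upper_half (- z) \<longleftrightarrow> \<not> upper_half z" by (auto simp: upper_half_def)
  then show ?thesis by (simp add: circle_label_def flip_def)
qed

lemma circle_label_polar:
  assumes "z \<in> sphere 0 1"
  defines "t \<equiv> magnitude (circle_label z)" and "\<sigma> \<equiv> (if positive (circle_label z) then 1 else -1)"
  shows "0 \<le> t" "t \<le> pi" "z $ 1 = \<sigma> * cos t" "z $ 2 = \<sigma> * sin t"
proof -
  have eq: "(z $ 1)\<^sup>2 + (z $ 2)\<^sup>2 = 1" using assms(1) by (simp only: circle_coords)
  have t: "t = arccos (\<sigma> * z $ 1)" and sq: "\<sigma> * \<sigma> = 1" by (simp_all add: t_def \<sigma>_def circle_label_def)
  have "(z $ 1)\<^sup>2 \<le> 1" using eq zero_le_power2[of "z $ 2"] by linarith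
  then have le: "\<bar>\<sigma> * z $ 1\<bar> \<le> 1" by (simp add: \<sigma>_def abs_square_le_1)
  show "0 \<le> t" "t \<le> pi" unfolding t using le by (simp_all add: arccos_lbound arccos_ubound abs_le_iff)
  show "z $ 1 = \<sigma> * cos t" unfolding t using le sq by (simp add: cos_arccos_abs flip: mult.assoc)
  have "sin t = sqrt (1 - (z $ 1)\<^sup>2)"
    unfolding t using le by (simp add: sin_arccos_abs \<sigma>_def)
  also have "1 - (z $ 1)\<^sup>2 = (z $ 2)\<^sup>2" using eq by linarith
  also have "sqrt ((z $ 2)\<^sup>2) = \<sigma> * z $ 2"
    by (auto simp: \<sigma>_def circle_label_def upper_half_def)
  finally show "z $ 2 = \<sigma> * sin t" using sq by (simp flip: mult.assoc)
qed

lemma arccos_inner_circle: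
  assumes z: "z \<in> sphere 0 1" and z': "z' \<in> sphere 0 1"
  defines "d \<equiv> \<bar>magnitude (circle_label z) - magnitude (circle_label z')\<bar>"
  shows "arccos (z \<bullet> z') = (if positive (circle_label z) = positive (circle_label z') then d else pi - d)"
proof -
  note P = circle_label_polar[OF z] and P' = circle_label_polar[OF z']
  have d: "0 \<le> d" "d \<le> pi" using P(1,2) P'(1,2) by (auto simp: d_def)
  have "cos d = cos (magnitude (circle_label z) - magnitude (circle_label z'))" by (simp add: d_def)
  then have "z \<bullet> z' = (if positive (circle_label z) = positive (circle_label z') then cos d else - cos d)"
    using P(3,4) P'(3,4) by (auto simp: inner_vec_def sum_2 cos_diff split: if_splits)
  then show ?thesis using d by (simp add: arccos_minus arccos_cos)
qed

lemma alternates_nth: "alternates s v \<Longrightarrow> j < length v \<Longrightarrow> v ! j \<longleftrightarrow> (s \<longleftrightarrow> even j)"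
  by (induction v arbitrary: s j) (auto simp: nth_Cons split: nat.splits)

text \<open>
  Consecutive points have opposite signs, so small distances force the magnitudes to climb by at
  least \<open>\<pi> - \<rho>\<close> at each of the \<open>n\<close> steps. There is room for a total climb of \<open>\<pi>\<close>, and only of \<open>\<rho>\<close> if the
  first and the last point have equal signs.
\<close>

lemma alternating_circle_diameter:
  assumes len: "length w = Suc n" and sph: "set w \<subseteq> sphere 0 1"
    and alt: "alternates s (sorted_signs (map circle_label w))"
    and diam: "\<And>x y. x \<in> set w \<Longrightarrow> y \<in> set w \<Longrightarrow> arccos (x \<bullet> y) \<le> \<rho>"
  shows "even n \<Longrightarrow> real n * pi \<le> real (Suc n) * \<rho>" and "odd n \<Longrightarrow> (real n - 1) * pi \<le> real n * \<rho>"
proof -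
  define L where "L = sort (map circle_label w)"
  define t where "t j = magnitude (L ! j)" for j
  have lenL: "length L = Suc n" by (simp add: L_def len)
  have pt: "\<exists>x\<in>set w. L ! j = circle_label x" if "j \<le> n" for j
  proof -
    have "L ! j \<in> set L" using that lenL by simp
    then show ?thesis by (auto simp: L_def)
  qed
  have t: "0 \<le> t j" "t j \<le> pi" if "j \<le> n" for j
    using pt[OF that] circle_label_polar(1,2) sph by (force simp: t_def)+
  have mono: "t i \<le> t j" if "i \<le> j" "j \<le> n" for i j
    using sorted_nth_mono[of L i j] that lenL by (auto simp: t_def L_def less_eq_label_def)
  have sign: "positive (L ! j) \<longleftrightarrow> (s \<longleftrightarrow> even j)" if "j \<le> n" for j
    using alternates_nth[OF alt, of j] that lenL by (simp add: sorted_signs_def L_def)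
  have gap: "(if even (i + j) then t j - t i else pi - (t j - t i)) \<le> \<rho>" if ij: "i \<le> j" "j \<le> n" for i j
  proof -
    obtain x y where xy: "x \<in> set w" "y \<in> set w" "L ! i = circle_label x" "L ! j = circle_label y"
      using pt[of i] pt[of j] ij by auto
    have "arccos (y \<bullet> x) = (if even (i + j) then t j - t i else pi - (t j - t i))"
      using arccos_inner_circle[of y x] xy sph sign[of i] sign[of j] ij mono[OF ij]
      by (auto simp: t_def subset_iff)
    with diam[OF xy(2,1)] show ?thesis by simp
  qed
  have climb: "t 0 + real j * (pi - \<rho>) \<le> t j" if "j \<le> n" for j
    using that
  proof (induction j)
    case (Suc j)
    with gap[of j "Suc j"] show ?case by (simp add: algebra_simps)
  qed simp
  show "real n * pi \<le> real (Suc n) * \<rho>" if "even n"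
    using climb[of n] gap[of 0 n] that by (simp add: algebra_simps)
  show "(real n - 1) * pi \<le> real n * \<rho>" if "odd n"
    using climb[of n] t[of 0] t[of n] by (simp add: algebra_simps)
qed

text \<open>
  The smallest \<open>\<rho>\<close> allowed by \<open>alternating_circle_diameter\<close>.
\<close>

definition circle_diameter_bound :: "nat \<Rightarrow> real" where
  "circle_diameter_bound n = pi * (if even n then real n / (real n + 1) else (real n - 1) / real n)"

text \<open>
  A quantitative Borsuk-Ulam theorem: an odd map to the circle has, at every scale, jumps of at
  least this size.
\<close>

theorem odd_map_to_circle:
  fixes \<phi> :: "'a::euclidean_space \<Rightarrow> real ^ 2"
  assumes dim: "DIM('a) = Suc n" and "\<epsilon> > 0"
    and sph: "\<And>x. x \<in> sphere 0 1 \<Longrightarrow> \<phi> x \<in> sphere 0 1"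
    and odd: "\<And>x. x \<in> sphere 0 1 \<Longrightarrow> \<phi> (- x) = - \<phi> x"
    and jump: "\<And>x y. x \<in> sphere 0 1 \<Longrightarrow> y \<in> sphere 0 1 \<Longrightarrow> dist x y < \<epsilon> \<Longrightarrow> arccos (\<phi> x \<bullet> \<phi> y) \<le> \<rho>"
  shows "circle_diameter_bound n \<le> \<rho>"
proof (cases "\<rho> < pi")
  case False
  moreover have "circle_diameter_bound n \<le> pi * 1"
    unfolding circle_diameter_bound_def by (intro mult_left_mono) (auto simp: divide_le_eq_1)
  ultimately show ?thesis by simp
next
  case True
  obtain w s where w: "length w = Suc n" "set w \<subseteq> sphere 0 1"
    "\<And>x y. x \<in> set w \<Longrightarrow> y \<in> set w \<Longrightarrow> dist x y < \<epsilon>"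
    "alternates s (sorted_signs (map (\<lambda>x. circle_label (\<phi> x)) w))"
  proof (rule alternating_simplex[OF dim \<open>\<epsilon> > 0\<close>, of "\<lambda>x. circle_label (\<phi> x)"])
    show "circle_label (\<phi> (- x)) = flip (circle_label (\<phi> x))" if "x \<in> sphere 0 1" for x
      using circle_label_uminus[OF sph[OF that]] odd[OF that] by simp
    show "circle_label (\<phi> y) \<noteq> flip (circle_label (\<phi> x))"
      if "x \<in> sphere 0 1" "y \<in> sphere 0 1" "dist x y < \<epsilon>" for x y
    proof
      assume "circle_label (\<phi> y) = flip (circle_label (\<phi> x))"
      then have "arccos (\<phi> x \<bullet> \<phi> y) = pi"
        using arccos_inner_circle[OF sph sph, OF that(1,2)] by (simp add: flip_def)
      with jump[OF that] True show False by simp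
    qed
  qed blast
  have "arccos (x \<bullet> y) \<le> \<rho>" if "x \<in> set (map \<phi> w)" "y \<in> set (map \<phi> w)" for x y
    using that jump w(2,3) by (auto simp: subset_iff)
  moreover have "set (map \<phi> w) \<subseteq> sphere 0 1" using w(2) sph by auto
  moreover have "alternates s (sorted_signs (map circle_label (map \<phi> w)))"
    using w(4) by (simp add: comp_def)
  ultimately have "(even n \<longrightarrow> real n * pi \<le> real (Suc n) * \<rho>) \<and> (odd n \<longrightarrow> (real n - 1) * pi \<le> real n * \<rho>)"
    using alternating_circle_diameter[of "map \<phi> w" n s \<rho>] w(1) by simp
  moreover have "odd n \<Longrightarrow> n > 0" by (rule odd_pos)
  ultimately show ?thesis
    by (auto simp: circle_diameter_bound_def divide_simps algebra_simps)
qed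

text \<open>
  Any map can be replaced by an odd one of no larger distortion: changing the sign of one of two
  points replaces both distances \<open>d\<close> by \<open>\<pi> - d\<close>. The jumps of an odd map are at most its distortion
  plus the distance of the points.
\<close>

theorem distortion_to_circle:
  fixes \<psi> :: "'a::euclidean_space \<Rightarrow> real ^ 2"
  assumes dim: "DIM('a) = Suc n"
    and sph: "\<And>x. x \<in> sphere 0 1 \<Longrightarrow> \<psi> x \<in> sphere 0 1"
    and dis: "\<And>x y. x \<in> sphere 0 1 \<Longrightarrow> y \<in> sphere 0 1 \<Longrightarrow>
      \<bar>arccos (\<psi> x \<bullet> \<psi> y) - arccos (x \<bullet> y)\<bar> \<le> \<delta>"
  shows "circle_diameter_bound n \<le> \<delta>"
proof (rule field_le_epsilon)
  fix \<eta> :: real assume "\<eta> > 0"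
  define \<eta>' where "\<eta>' = min \<eta> pi"
  have \<eta>': "0 < \<eta>'" "\<eta>' \<le> pi" "\<eta>' \<le> \<eta>" using \<open>\<eta> > 0\<close> by (auto simp: \<eta>'_def)
  \<comment> \<open>\<open>r\<close> picks a point from each antipodal pair. The choice is antipodally invariant since it
    depends only on the pair as a set.\<close>
  define r where "r x = (SOME y. y \<in> {x, - x})" for x :: 'a
  have r: "r x = x \<or> r x = - x" for x
    using someI[of "\<lambda>y. y \<in> {x, - x}" x] by (auto simp: r_def)
  have r_uminus: "r (- x) = r x" for x
    by (simp add: r_def insert_commute)
  define \<sigma> :: "'a \<Rightarrow> real" where "\<sigma> x = (if r x = x then 1 else -1)" for x
  define \<phi> where "\<phi> x = \<sigma> x *\<^sub>R \<psi> (\<sigma> x *\<^sub>R x)" for x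
  have \<sigma>: "\<bar>\<sigma> x\<bar> = 1" for x by (simp add: \<sigma>_def)
  have \<sigma>_uminus: "\<sigma> (- x) = - \<sigma> x" if "x \<in> sphere 0 1" for x
  proof -
    have "x \<noteq> - x"
    proof
      assume "x = - x"
      then have "2 *\<^sub>R x = 0" by (metis add.right_inverse scaleR_2)
      with that show False by simp
    qed
    with r[of x] show ?thesis by (auto simp: \<sigma>_def r_uminus)
  qed
  \<comment> \<open>The chord that belongs to the angle \<open>\<eta>'\<close>.\<close>
  define \<epsilon> where "\<epsilon> = sqrt (2 * (1 - cos \<eta>'))"
  have "cos \<eta>' < 1" using \<eta>' cos_monotone_0_pi[of 0 \<eta>'] by simp
  then have \<epsilon>: "\<epsilon> > 0" by (simp add: \<epsilon>_def)
  show "circle_diameter_bound n \<le> \<delta> + \<eta>"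
  proof (rule odd_map_to_circle[OF dim \<epsilon>, of \<phi>])
    show "\<phi> x \<in> sphere 0 1" if "x \<in> sphere 0 1" for x
      using sph[of "\<sigma> x *\<^sub>R x"] that \<sigma> by (simp add: \<phi>_def)
    show "\<phi> (- x) = - \<phi> x" if "x \<in> sphere 0 1" for x
      by (simp add: \<phi>_def \<sigma>_uminus[OF that])
    show "arccos (\<phi> x \<bullet> \<phi> y) \<le> \<delta> + \<eta>"
      if x: "x \<in> sphere 0 1" and y: "y \<in> sphere 0 1" and near: "dist x y < \<epsilon>" for x y
    proof -
      define x' y' where "x' = \<sigma> x *\<^sub>R x" and "y' = \<sigma> y *\<^sub>R y"
      have x': "x' \<in> sphere 0 1" "y' \<in> sphere 0 1" using x y \<sigma> by (auto simp: x'_def y'_def)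
      have bd: "\<bar>x' \<bullet> y'\<bar> \<le> 1" "\<bar>\<psi> x' \<bullet> \<psi> y'\<bar> \<le> 1"
        using abs_inner_sphere_le_1 x' sph by blast+
      have minus: "arccos (- a) = pi - arccos a" if "\<bar>a\<bar> \<le> 1" for a
        using that by (intro arccos_minus) auto
      have cases: "\<sigma> x * \<sigma> y = 1 \<or> \<sigma> x * \<sigma> y = -1" by (simp add: \<sigma>_def)
      have e1: "\<phi> x \<bullet> \<phi> y = \<sigma> x * \<sigma> y * (\<psi> x' \<bullet> \<psi> y')" by (simp add: \<phi>_def x'_def y'_def)
      have e2: "x \<bullet> y = \<sigma> x * \<sigma> y * (x' \<bullet> y')"
        by (simp add: x'_def y'_def \<sigma>_def)
      have "\<bar>arccos (\<phi> x \<bullet> \<phi> y) - arccos (x \<bullet> y)\<bar> \<le> \<delta>"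
        using cases dis[OF x'] bd minus unfolding e1 e2 by auto
      moreover have "arccos (x \<bullet> y) \<le> \<eta>'"
      proof -
        have "(dist x y)\<^sup>2 < \<epsilon>\<^sup>2" using near by (intro power_strict_mono) auto
        moreover have "(dist x y)\<^sup>2 = 2 - 2 * (x \<bullet> y)"
          using x y unfolding dist_norm power2_norm_eq_inner
          by (simp add: inner_diff_left inner_diff_right inner_commute norm_eq_1)
        moreover have "\<epsilon>\<^sup>2 = 2 * (1 - cos \<eta>')" using \<open>cos \<eta>' < 1\<close> by (simp add: \<epsilon>_def)
        ultimately have "cos \<eta>' \<le> x \<bullet> y" by simp
        moreover have "\<bar>x \<bullet> y\<bar> \<le> 1" using abs_inner_sphere_le_1 x y by blast
        ultimately have "arccos (x \<bullet> y) \<le> arccos (cos \<eta>')" by (intro arccos_le_arccos) auto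
        then show ?thesis using \<eta>' by (simp add: arccos_cos)
      qed
      ultimately show ?thesis using \<eta>'(3) by linarith
    qed
  qed
qed

section \<open>Gromov-Hausdorff distance\<close>

text \<open>
  The two spaces side by side, all cross distances being \<open>r\<close>; a metric if \<open>r > 0\<close> and neither space
  has a diameter exceeding \<open>2 r\<close>.
\<close>

fun sum_dist :: "'a metric \<Rightarrow> 'b metric \<Rightarrow> real \<Rightarrow> 'a + 'b \<Rightarrow> 'a + 'b \<Rightarrow> real" where
  "sum_dist X Y r (Inl x) (Inl x') = mdist X x x'"
| "sum_dist X Y r (Inr y) (Inr y') = mdist Y y y'"
| "sum_dist X Y r _ _ = r"

text \<open>
  Needed because the Gromov-Hausdorff distance is an infimum of reals, which obeys lower bounds only
  when it is taken over a nonempty set.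
\<close>

lemma common_isometric_embedding_exists:
  fixes X :: "'a metric" and Y :: "'b metric"
  assumes r: "r > 0"
    and X: "\<And>x x'. x \<in> mspace X \<Longrightarrow> x' \<in> mspace X \<Longrightarrow> mdist X x x' \<le> 2 * r"
    and Y: "\<And>y y'. y \<in> mspace Y \<Longrightarrow> y' \<in> mspace Y \<Longrightarrow> mdist Y y y' \<le> 2 * r"
  shows "\<exists>(Z :: ('a + 'b) metric) f g. isometric_embedding X Z f \<and> isometric_embedding Y Z g"
proof -
  let ?M = "Inl ` mspace X \<union> Inr ` mspace Y"
  have M: "Metric_space ?M (sum_dist X Y r)"
  proof
    fix p q s :: "'a + 'b"
    show "0 \<le> sum_dist X Y r p q" using r by (cases p; cases q) auto
    show "sum_dist X Y r p q = sum_dist X Y r q p" by (cases p; cases q) (auto simp: mdist_commute)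
    assume p: "p \<in> ?M" and q: "q \<in> ?M"
    then show "sum_dist X Y r p q = 0 \<longleftrightarrow> p = q" using r by auto
    assume s: "s \<in> ?M"
    show "sum_dist X Y r p s \<le> sum_dist X Y r p q + sum_dist X Y r q s"
      using p q s by (auto intro: mdist_triangle X Y)
  qed
  let ?Z = "metric (?M, sum_dist X Y r)"
  have "isometric_embedding X ?Z Inl" "isometric_embedding Y ?Z Inr"
    using M by (auto simp: isometric_embedding_def Metric_space.mspace_metric Metric_space.mdist_metric)
  then show ?thesis by blast
qed

text \<open>
  The supremum in the Hausdorff distance dominates each of its terms only if it is bounded; the
  bound \<open>D\<close> on distances from \<open>y\<close> secures this.
\<close>

lemma hausdorff_nearest:
  assumes f: "isometric_embedding X Z f" and g: "isometric_embedding Y Z g"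
    and ne: "mspace X \<noteq> {}" and y: "y \<in> mspace Y" and bdd: "\<And>y'. y' \<in> mspace Y \<Longrightarrow> mdist Y y y' \<le> D"
    and less: "hausdorff_dist Z (f ` mspace X) (g ` mspace Y) < h"
  shows "\<exists>x\<in>mspace X. mdist Z (f x) (g y) < h"
proof -
  let ?A = "f ` mspace X" and ?B = "g ` mspace Y"
  obtain x0 where x0: "x0 \<in> mspace X" using ne by blast
  have in_Z: "x \<in> mspace X \<Longrightarrow> f x \<in> mspace Z" "y \<in> mspace Y \<Longrightarrow> g y \<in> mspace Z" for x y
    using f g by (auto simp: isometric_embedding_def)
  have bddA: "bdd_below ((\<lambda>a. mdist Z a b) ` ?A)" for b by (rule bdd_belowI2[of _ 0]) simp
  have "(INF a\<in>?A. mdist Z a (g y')) \<le> mdist Z (f x0) (g y) + D" if "y' \<in> mspace Y" for y'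
  proof -
    have "(INF a\<in>?A. mdist Z a (g y')) \<le> mdist Z (f x0) (g y')"
      using x0 by (intro cINF_lower bddA) auto
    also have "\<dots> \<le> mdist Z (f x0) (g y) + mdist Z (g y) (g y')"
      using in_Z x0 y that by (intro mdist_triangle) auto
    also have "mdist Z (g y) (g y') \<le> D"
      using g y that bdd[OF that] by (simp add: isometric_embedding_def)
    finally show ?thesis by simp
  qed
  then have "bdd_above ((\<lambda>b. INF a\<in>?A. mdist Z a b) ` ?B)" by (auto intro!: bdd_aboveI2)
  then have "(INF a\<in>?A. mdist Z a (g y)) \<le> (SUP b\<in>?B. INF a\<in>?A. mdist Z a b)"
    using y by (intro cSUP_upper) auto
  also have "\<dots> < h" using less by (simp add: hausdorff_dist_def)
  finally show ?thesis using ne bddA by (subst (asm) cINF_less_iff) auto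
qed

text \<open>
  Sending a point of the sphere to a point of the circle at distance at most \<open>h\<close> from it changes
  distances by at most \<open>2 h\<close>, by the triangle inequality.
\<close>

theorem hausdorff_dist_circle_sphere:
  fixes Z :: "'z metric" and g :: "'a::euclidean_space \<Rightarrow> 'z"
  assumes dim: "DIM('a) = Suc n"
    and f: "isometric_embedding (geodesic_sphere :: (real ^ 2) metric) Z f"
    and g: "isometric_embedding (geodesic_sphere :: 'a metric) Z g"
  shows "circle_diameter_bound n \<le> 2 * hausdorff_dist Z (f ` sphere 0 1) (g ` sphere 0 1)"
proof (rule field_le_epsilon)
  fix \<eta> :: real assume \<eta>: "\<eta> > 0"
  let ?h = "hausdorff_dist Z (f ` sphere 0 1) (g ` sphere 0 1)"
  have in_Z: "x \<in> sphere 0 1 \<Longrightarrow> f x \<in> mspace Z" "y \<in> sphere 0 1 \<Longrightarrow> g y \<in> mspace Z" for x y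
    using f g by (auto simp: isometric_embedding_def)
  have "\<exists>x\<in>sphere 0 1. mdist Z (f x) (g y) < ?h + \<eta> / 2" if y: "y \<in> sphere 0 1" for y
  proof -
    have "mdist geodesic_sphere y y' \<le> pi" if "y' \<in> sphere 0 1" for y'
      using abs_inner_sphere_le_1[OF y that] by (simp only: mdist_geodesic_sphere[OF y that] arccos_ubound abs_le_iff) (simp add: arccos_ubound)
    moreover have "mspace (geodesic_sphere :: (real ^ 2) metric) \<noteq> {}" by simp
    ultimately show ?thesis
      using hausdorff_nearest[OF f g, of y pi "?h + \<eta> / 2"] y \<eta> by simp
  qed
  then obtain \<psi> where \<psi>: "\<And>y. y \<in> sphere 0 1 \<Longrightarrow> \<psi> y \<in> sphere 0 1"
    "\<And>y. y \<in> sphere 0 1 \<Longrightarrow> mdist Z (f (\<psi> y)) (g y) < ?h + \<eta> / 2"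
    by metis
  have "\<bar>arccos (\<psi> x \<bullet> \<psi> y) - arccos (x \<bullet> y)\<bar> \<le> 2 * ?h + \<eta>" if x: "x \<in> sphere 0 1" and y: "y \<in> sphere 0 1" for x y
  proof -
    have "mdist Z (f (\<psi> x)) (f (\<psi> y)) = arccos (\<psi> x \<bullet> \<psi> y)" "mdist Z (g x) (g y) = arccos (x \<bullet> y)"
      using f g x y \<psi>(1) by (simp_all add: isometric_embedding_def mdist_geodesic_sphere)
    moreover have "mdist Z (f (\<psi> x)) (f (\<psi> y)) \<le> mdist Z (f (\<psi> x)) (g x) + mdist Z (g x) (g y) + mdist Z (f (\<psi> y)) (g y)"
      using mdist_triangle[of "f (\<psi> x)" Z "g x" "f (\<psi> y)"] mdist_triangle[of "g x" Z "g y" "f (\<psi> y)"]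
        in_Z x y \<psi>(1) by (simp add: mdist_commute)
    moreover have "mdist Z (g x) (g y) \<le> mdist Z (f (\<psi> x)) (g x) + mdist Z (f (\<psi> x)) (f (\<psi> y)) + mdist Z (f (\<psi> y)) (g y)"
      using mdist_triangle[of "g x" Z "f (\<psi> x)" "g y"] mdist_triangle[of "f (\<psi> x)" Z "f (\<psi> y)" "g y"]
        in_Z x y \<psi>(1) by (simp add: mdist_commute)
    ultimately show ?thesis using \<psi>(2)[OF x] \<psi>(2)[OF y] by linarith
  qed
  with \<psi>(1) show "circle_diameter_bound n \<le> 2 * ?h + \<eta>" by (rule distortion_to_circle[OF dim])
qed

theorem GH_dist_circle_sphere:
  assumes dim: "DIM('a::euclidean_space) = Suc n"
  shows "circle_diameter_bound n / 2 \<le>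
    GH_dist (geodesic_sphere :: (real ^ 2) metric) (geodesic_sphere :: 'a metric)"
proof -
  have diam: "mdist geodesic_sphere x y \<le> 2 * (pi / 2)"
    if "x \<in> mspace geodesic_sphere" "y \<in> mspace geodesic_sphere" for x y :: "'b::euclidean_space"
    using that abs_inner_sphere_le_1[of x y] by (simp add: mdist_geodesic_sphere arccos_ubound abs_le_iff)
  have "pi / 2 > (0 :: real)" by simp
  then have "\<exists>(Z :: (real ^ 2 + 'a) metric) (f :: real ^ 2 \<Rightarrow> _) (g :: 'a \<Rightarrow> _).
      isometric_embedding geodesic_sphere Z f \<and> isometric_embedding geodesic_sphere Z g"
    by (rule common_isometric_embedding_exists) (rule diam; assumption)+
  then obtain Z :: "(real ^ 2 + 'a) metric" and f :: "real ^ 2 \<Rightarrow> _" and g :: "'a \<Rightarrow> _"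
    where fg: "isometric_embedding geodesic_sphere Z f" "isometric_embedding geodesic_sphere Z g"
    by (elim exE conjE)
  show ?thesis
    unfolding GH_dist_def
  proof (rule cInf_greatest)
    show "{hausdorff_dist Z (f ` mspace geodesic_sphere) (g ` mspace geodesic_sphere) |
        (Z :: (real ^ 2 + 'a) metric) (f :: real ^ 2 \<Rightarrow> _) (g :: 'a \<Rightarrow> _). isometric_embedding geodesic_sphere Z f \<and>
          isometric_embedding geodesic_sphere Z g} \<noteq> {}" (is "?S \<noteq> {}")
    proof -
      have "hausdorff_dist Z (f ` mspace geodesic_sphere) (g ` mspace geodesic_sphere) \<in> ?S"
        by (rule CollectI, rule exI[of _ Z], rule exI[of _ f], rule exI[of _ g]) (simp add: fg)
      then show ?thesis by (metis empty_iff)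
    qed
  next
    fix d assume "d \<in> {hausdorff_dist Z (f ` mspace geodesic_sphere) (g ` mspace geodesic_sphere) |
        (Z :: (real ^ 2 + 'a) metric) (f :: real ^ 2 \<Rightarrow> _) (g :: 'a \<Rightarrow> _). isometric_embedding geodesic_sphere Z f \<and>
          isometric_embedding geodesic_sphere Z g}"
    then show "circle_diameter_bound n / 2 \<le> d"
    proof (elim CollectE exE conjE)
      fix Z :: "(real ^ 2 + 'a) metric" and f :: "real ^ 2 \<Rightarrow> _" and g :: "'a \<Rightarrow> _"
      assume "d = hausdorff_dist Z (f ` mspace geodesic_sphere) (g ` mspace geodesic_sphere)"
        "isometric_embedding geodesic_sphere Z f" "isometric_embedding geodesic_sphere Z g"
      then show ?thesis using hausdorff_dist_circle_sphere[OF dim, of Z f g] by simp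
    qed
  qed
qed

theorem corollary1p14:
  fixes n :: nat
  assumes "n > 1" and "CARD('n::finite) = n + 1"
  shows "GH_dist (geodesic_sphere :: (real ^ 2) metric) (geodesic_sphere :: (real ^ 'n) metric)
           \<ge> pi * max (1 / 3) (1 / 2 * ((real n - 1) / (real n + 1)))"
proof -
  let ?q = "(real n - 1) / (real n + 1)"
  let ?b = "if even n then real n / (real n + 1) else (real n - 1) / real n"
  have "2 / 3 \<le> ?b \<and> ?q \<le> ?b"
  proof (cases "even n")
    case True
    have "2 / 3 \<le> real n / (real n + 1)" using assms(1) by (simp add: divide_simps)
    moreover have "?q \<le> real n / (real n + 1)" by (intro divide_right_mono) auto
    ultimately show ?thesis using True by simp
  next
    case False
    with assms(1) have "n \<ge> 3" by presburger
    then have n: "real n \<ge> 3" by simp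
    then have "2 / 3 \<le> (real n - 1) / real n" by (simp add: divide_simps)
    moreover have "?q \<le> (real n - 1) / real n"
      using n by (intro divide_left_mono) auto
    ultimately show ?thesis using False by simp
  qed
  moreover have "2 * max (1 / 3) (1 / 2 * q) \<le> b" if "2 / 3 \<le> b \<and> q \<le> b" for b q :: real
    using that by (auto simp: max_def)
  ultimately have "2 * max (1 / 3) (1 / 2 * ?q) \<le> ?b" by blast
  then have "pi * (2 * max (1 / 3) (1 / 2 * ?q)) \<le> circle_diameter_bound n"
    unfolding circle_diameter_bound_def by (rule mult_left_mono) simp
  moreover have "DIM(real ^ 'n) = Suc n" using assms(2) by simp
  ultimately show ?thesis using GH_dist_circle_sphere[where 'a = "real ^ 'n" and n = n] by linarith
qed

end
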